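(* Let $k$ and $n$ be positive integers. Let $p_k(n)$ denote the number of partitions of $n$ with parts not exceeding $k$. Then for any integer $b\ge 2$, $p_k(n)$ is equal to the number of $k$-color $b$-ary partitions of $n$ in which every part with color $i$ that occurs has multiplicity in the set $\{i,2i,\ldots,(b-1)i\}$ (for $1\le i\le k$).
   Context: For an integer $b\ge 2$, a $k$-color $b$-ary partition of $n$ is a finite multiset of colored parts, each colored part being a power $b^j$ ($j\ge 0$) together with a color $i\in\{1,\dots,k\}$, such that the sum of the parts, counted with multiplicity, is $n$. The order of the parts is irrelevant, and the same power with different colors gives different colored parts. The multiplicity of the colored part $(b^j,i)$ is the number of times it occurs in the multiset. The condition means that for each pair $(j,i)$ the multiplicity of $(b^j,i)$ is $0$ or lies in $\{i,2i,\ldots,(b-1)i\}$. *)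

theory Defs
  imports Main "HOL-Library.Multiset"
begin

definition partitions_parts_le :: "nat \<Rightarrow> nat \<Rightarrow> nat multiset set" where
  "partitions_parts_le k n =
     {P. sum_mset P = n \<and> (\<forall>x \<in># P. 1 \<le> x \<and> x \<le> k)}"

definition num_partitions_parts_le :: "nat \<Rightarrow> nat \<Rightarrow> nat" where
  "num_partitions_parts_le k n = card (partitions_parts_le k n)"

text \<open>A colored part is a pair \<open>(q, i)\<close> of its value \<open>q = b ^ j\<close> and its color \<open>i\<close>.\<close>

definition colored_bary_partitions :: "nat \<Rightarrow> nat \<Rightarrow> nat \<Rightarrow> (nat \<times> nat) multiset set" where
  "colored_bary_partitions b k n =
     {Q. (\<Sum>(q, i) \<in># Q. q) = n \<and> (\<forall>(q, i) \<in># Q. (\<exists>j. q = b ^ j) \<and> 1 \<le> i \<and> i \<le> k)}"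

definition admissible_multiplicities :: "nat \<Rightarrow> (nat \<times> nat) multiset \<Rightarrow> bool" where
  "admissible_multiplicities b Q \<longleftrightarrow>
     (\<forall>(q, i) \<in># Q. count Q (q, i) \<in> {m * i |m. 1 \<le> m \<and> m \<le> b - 1})"

text \<open>Both sets of partitions are finite, so \<^const>\<open>card\<close> really counts their elements.\<close>

lemma finite_multisets_bounded:
  assumes "finite A"
  shows "finite {M. set_mset M \<subseteq> A \<and> size M \<le> n}"
proof (rule finite_subset)
  show "{M. set_mset M \<subseteq> A \<and> size M \<le> n} \<subseteq> mset ` {xs. set xs \<subseteq> A \<and> length xs \<le> n}"
  proof
    fix M assume M: "M \<in> {M. set_mset M \<subseteq> A \<and> size M \<le> n}"
    obtain xs where "M = mset xs" using ex_mset by metis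
    with M show "M \<in> mset ` {xs. set xs \<subseteq> A \<and> length xs \<le> n}" by auto
  qed
  show "finite (mset ` {xs. set xs \<subseteq> A \<and> length xs \<le> n})"
    using finite_lists_length_le[OF assms] by (rule finite_imageI)
qed

lemma size_le_sum_mset:
  fixes f :: "'a \<Rightarrow> nat"
  assumes "\<forall>x \<in># M. 1 \<le> f x"
  shows "size M \<le> (\<Sum>x \<in># M. f x)"
  using assms by (induction M) auto

lemma finite_partitions_parts_le: "finite (partitions_parts_le k n)"
proof (rule finite_subset)
  show "partitions_parts_le k n \<subseteq> {M. set_mset M \<subseteq> {1..k} \<and> size M \<le> n}"
    using size_le_sum_mset[where f = "\<lambda>x. x"] by (fastforce simp: partitions_parts_le_def)
qed (intro finite_multisets_bounded finite_atLeastAtMost)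

lemma finite_colored_bary_partitions:
  assumes "b \<ge> 2"
  shows "finite (colored_bary_partitions b k n)"
proof (rule finite_subset)
  show "colored_bary_partitions b k n \<subseteq> {M. set_mset M \<subseteq> {0..n} \<times> {1..k} \<and> size M \<le> n}"
  proof
    fix Q assume Q: "Q \<in> colored_bary_partitions b k n"
    have sum: "(\<Sum>x \<in># Q. fst x) = n"
      using Q by (simp add: colored_bary_partitions_def case_prod_unfold)
    have parts: "(\<exists>j. fst x = b ^ j) \<and> 1 \<le> snd x \<and> snd x \<le> k" if "x \<in># Q" for x
      using Q that by (auto simp: colored_bary_partitions_def case_prod_unfold)
    have "\<forall>x \<in># Q. 1 \<le> fst x"
      using parts assms by fastforce
    with sum have size: "size Q \<le> n"
      using size_le_sum_mset[of Q fst] by simp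
    have "fst x \<le> n" if x: "x \<in># Q" for x
    proof -
      from x obtain R where "Q = add_mset x R" by (meson mset_add)
      with sum show ?thesis by auto
    qed
    with parts size show "Q \<in> {M. set_mset M \<subseteq> {0..n} \<times> {1..k} \<and> size M \<le> n}"
      by fastforce
  qed
qed (intro finite_multisets_bounded finite_cartesian_product finite_atLeastAtMost)

end

theory Submission
  imports Defs
begin

text \<open>
  A partition with parts at most \<open>k\<close> is a choice of multiplicities \<open>c\<^sub>1, \<dots>, c\<^sub>k\<close> with
  \<open>\<Sum>i. i * c\<^sub>i = n\<close>. Writing each multiplicity in base \<open>b\<close>, \<open>c\<^sub>i = \<Sum>j. d\<^sub>i\<^sub>j * b ^ j\<close> with
  \<open>d\<^sub>i\<^sub>j < b\<close>, turns this into \<open>\<Sum>i. \<Sum>j. (i * d\<^sub>i\<^sub>j) * b ^ j = n\<close>, which is the weight of the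
  colored \<open>b\<close>-ary partition in which \<open>(b ^ j, i)\<close> occurs \<open>i * d\<^sub>i\<^sub>j\<close> times. The multiplicities
  \<open>0, i, \<dots>, (b - 1) * i\<close> are exactly those of the form \<open>i * d\<close> with \<open>d\<close> a base-\<open>b\<close> digit, so
  existence and uniqueness of base-\<open>b\<close> expansions (\<open>sum_digits\<close> and \<open>digit_of_sum\<close>)
  make this a bijection.

  In the inverse direction no digits have to be named: the parts of color \<open>i\<close> have total value
  \<open>i * c\<^sub>i\<close>, so \<open>c\<^sub>i\<close> is that total divided by \<open>i\<close>.
\<close>

section \<open>Base-\<open>b\<close> expansions\<close>

lemma sum_digits:
  fixes b c :: nat
  shows "(\<Sum>j<N. (c div b ^ j mod b) * b ^ j) = c mod b ^ N"
proof (induction N)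
  case (Suc N)
  have "c mod b ^ Suc N = b ^ N * (c div b ^ N mod b) + c mod b ^ N"
    using mod_mult2_eq[of c "b ^ N" b] by (simp add: mult.commute)
  with Suc show ?case by (simp add: mult.commute)
qed simp

text \<open>By induction on the number of digits: splitting off the lowest one leaves
  \<open>d 0 + b * S\<close> with \<open>d 0 < b\<close>, where \<open>S\<close> is the number with the remaining digits.\<close>

lemma digit_of_sum:
  fixes b :: nat
  assumes "\<And>j. d j < b"
  shows "(\<Sum>j<N. d j * b ^ j) div b ^ l mod b = (if l < N then d l else 0)"
  using assms
proof (induction N arbitrary: d l)
  case (Suc N)
  let ?S = "\<Sum>j<N. d (Suc j) * b ^ j"
  have split: "(\<Sum>j<Suc N. d j * b ^ j) = d 0 + b * ?S"
    by (subst sum.lessThan_Suc_shift) (simp add: sum_distrib_left ac_simps)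
  show ?case
  proof (cases l)
    case 0
    with split Suc.prems show ?thesis by simp
  next
    case (Suc m)
    have "b > 0" using Suc.prems[of 0] by simp
    then have "(d 0 + b * ?S) div b ^ l = ?S div b ^ m"
      using Suc Suc.prems[of 0] by (simp add: div_mult2_eq)
    with split Suc.IH[of "\<lambda>j. d (Suc j)" m] Suc.prems Suc show ?thesis by simp
  qed
qed simp

section \<open>The total value of the parts of one color\<close>

lemma sum_mset_eq_sum_count:
  fixes f :: "'a \<Rightarrow> nat"
  assumes "finite A" "set_mset M \<subseteq> A"
  shows "(\<Sum>x\<in>#M. f x) = (\<Sum>x\<in>A. count M x * f x)"
  using assms(2)
proof (induction M)
  case (add y M)
  have "(\<Sum>x\<in>A. count (add_mset y M) x * f x) =
      (\<Sum>x\<in>A. count M x * f x + (if x = y then f x else 0))"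
    by (intro sum.cong) auto
  also have "\<dots> = (\<Sum>x\<in>A. count M x * f x) + f y"
    using add.prems assms(1) by (simp add: sum.distrib)
  finally show ?case using add by simp
qed simp

definition color_weight :: "(nat \<times> nat) multiset \<Rightarrow> nat \<Rightarrow> nat" where
  "color_weight Q i = (\<Sum>x\<in>#filter_mset (\<lambda>x. snd x = i) Q. fst x)"

lemma sum_color_weight:
  assumes "finite I" "snd ` set_mset Q \<subseteq> I"
  shows "(\<Sum>i\<in>I. color_weight Q i) = (\<Sum>x\<in>#Q. fst x)"
  using assms(2)
proof (induction Q)
  case (add y Q)
  have "(\<Sum>i\<in>I. color_weight (add_mset y Q) i) =
      (\<Sum>i\<in>I. color_weight Q i + (if i = snd y then fst y else 0))"
    by (intro sum.cong) (auto simp: color_weight_def)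
  also have "\<dots> = (\<Sum>i\<in>I. color_weight Q i) + fst y"
    using add.prems assms(1) by (simp add: sum.distrib)
  finally show ?case using add by simp
qed (simp add: color_weight_def)

lemma color_weight_bary:
  fixes b :: nat
  assumes "b \<ge> 2"
    and powers: "\<And>q. (q, i) \<in># Q \<Longrightarrow> \<exists>j<N. q = b ^ j"
  shows "color_weight Q i = (\<Sum>j<N. count Q (b ^ j, i) * b ^ j)"
proof -
  let ?A = "(\<lambda>j. (b ^ j, i)) ` {..<N}"
  have inj: "inj_on (\<lambda>j. (b ^ j, i)) {..<N}"
    using assms(1) by (auto simp: inj_on_def)
  have "set_mset (filter_mset (\<lambda>x. snd x = i) Q) \<subseteq> ?A"
    using powers by fastforce
  then have "color_weight Q i =
      (\<Sum>x\<in>?A. count (filter_mset (\<lambda>x. snd x = i) Q) x * fst x)"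
    unfolding color_weight_def by (intro sum_mset_eq_sum_count) auto
  also have "\<dots> = (\<Sum>j<N. count Q (b ^ j, i) * b ^ j)"
    by (subst sum.reindex[OF inj]) simp
  finally show ?thesis .
qed

section \<open>The bijection\<close>

text \<open>For \<open>q = b ^ j\<close> the number \<open>count P i div q mod b\<close> is the \<open>j\<close>-th base-\<open>b\<close> digit of the
  multiplicity of \<open>i\<close>.\<close>

definition expand_multiplicities :: "nat \<Rightarrow> nat multiset \<Rightarrow> (nat \<times> nat) multiset" where
  "expand_multiplicities b P = Abs_multiset
     (\<lambda>(q, i). if q \<in> range ((^) b) then i * (count P i div q mod b) else 0)"

definition collapse_colors :: "(nat \<times> nat) multiset \<Rightarrow> nat multiset" where
  "collapse_colors Q = (\<Sum>i\<in>snd ` set_mset Q. replicate_mset (color_weight Q i div i) i)"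

lemma count_expand_multiplicities:
  "count (expand_multiplicities b P) (q, i) =
     (if q \<in> range ((^) b) then i * (count P i div q mod b) else 0)"
proof -
  let ?f = "\<lambda>(q, i). if q \<in> range ((^) b) then i * (count P i div q mod b) else 0"
  have "{x. ?f x > 0} \<subseteq> (\<Union>i\<in>set_mset P. {0..count P i} \<times> {i})"
  proof
    fix x assume "x \<in> {x. ?f x > 0}"
    then obtain q i where x: "x = (q, i)" and "count P i div q mod b \<noteq> 0"
      by (cases x) (auto split: if_splits)
    then have "count P i div q \<noteq> 0" by (metis mod_0)
    then have "q \<le> count P i" "i \<in># P"
      by (auto simp: div_eq_0_iff intro: count_inI)
    with x show "x \<in> (\<Union>i\<in>set_mset P. {0..count P i} \<times> {i})" by auto
  qed
  then have "finite {x. ?f x > 0}" by (rule finite_subset) simp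
  then show ?thesis
    unfolding expand_multiplicities_def by (subst count_Abs_multiset) auto
qed

lemma count_collapse_colors: "count (collapse_colors Q) i = color_weight Q i div i"
proof (cases "i \<in> snd ` set_mset Q")
  case False
  then have "filter_mset (\<lambda>x. snd x = i) Q = {#}"
    by (intro multiset_eqI) (force simp: not_in_iff)
  then have "color_weight Q i = 0" by (simp only: color_weight_def) simp
  moreover have "count (collapse_colors Q) i = 0"
    unfolding collapse_colors_def count_sum using False by (intro sum.neutral) auto
  ultimately show ?thesis by simp
qed (simp add: collapse_colors_def count_sum)

lemma in_expand_multiplicitiesD:
  assumes "(q, i) \<in># expand_multiplicities b P"
  obtains j where "q = b ^ j" "b ^ j \<le> count P i" "i \<in># P" "i > 0"
    "count P i div b ^ j mod b \<noteq> 0"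
proof -
  have "count (expand_multiplicities b P) (q, i) \<noteq> 0" using assms by simp
  then obtain j where j: "q = b ^ j" "i > 0" "count P i div b ^ j mod b \<noteq> 0"
    unfolding count_expand_multiplicities by (auto split: if_splits)
  then have "count P i div b ^ j \<noteq> 0" by (metis mod_0)
  then have "b ^ j \<le> count P i" "i \<in># P"
    by (auto simp: div_eq_0_iff intro: count_inI)
  with j that show ?thesis by blast
qed

lemma color_weight_expand_multiplicities:
  assumes "b \<ge> 2"
  shows "color_weight (expand_multiplicities b P) i = i * count P i"
proof -
  \<comment> \<open>The multiplicity itself bounds its number of digits, since \<open>j < b ^ j\<close>.\<close>
  let ?c = "count P i"
  have less: "j < b ^ j" for j
    using assms by (intro less_exp[THEN less_le_trans] power_mono) auto
  have "color_weight (expand_multiplicities b P) i =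
      (\<Sum>j<?c. count (expand_multiplicities b P) (b ^ j, i) * b ^ j)"
    using assms
  proof (rule color_weight_bary)
    fix q assume "(q, i) \<in># expand_multiplicities b P"
    then obtain j where "q = b ^ j" "b ^ j \<le> ?c"
      by (rule in_expand_multiplicitiesD)
    then show "\<exists>j<?c. q = b ^ j" using less[of j] by (intro exI[of _ j]) auto
  qed
  also have "\<dots> = i * (\<Sum>j<?c. (?c div b ^ j mod b) * b ^ j)"
    by (simp add: count_expand_multiplicities sum_distrib_left mult.assoc)
  also have "\<dots> = i * ?c"
    using less[of ?c] by (simp add: sum_digits)
  finally show ?thesis .
qed

lemma expand_multiplicities_in:
  assumes "b \<ge> 2" and P: "P \<in> partitions_parts_le k n"
  shows "expand_multiplicities b P \<in> {Q \<in> colored_bary_partitions b k n. admissible_multiplicities b Q}"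
proof -
  let ?Q = "expand_multiplicities b P"
  have parts: "1 \<le> i \<and> i \<le> k" if "i \<in># P" for i
    using P that by (auto simp: partitions_parts_le_def)
  have mem: "(\<exists>j. q = b ^ j) \<and> 1 \<le> i \<and> i \<le> k" if "(q, i) \<in># ?Q" for q i
    using that parts by (elim in_expand_multiplicitiesD) auto
  have "(\<Sum>x\<in>#?Q. fst x) = (\<Sum>i\<in>{1..k}. color_weight ?Q i)"
    using mem by (intro sum_color_weight[symmetric]) force+
  also have "\<dots> = (\<Sum>i\<in>{1..k}. count P i * i)"
    using assms(1) by (simp add: color_weight_expand_multiplicities mult.commute)
  also have "\<dots> = sum_mset P"
    using sum_mset_eq_sum_count[of "{1..k}" P "\<lambda>x. x"] parts by fastforce
  also have "\<dots> = n" using P by (simp add: partitions_parts_le_def)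
  finally have "?Q \<in> colored_bary_partitions b k n"
    using mem by (auto simp: colored_bary_partitions_def case_prod_unfold)
  moreover have "admissible_multiplicities b ?Q"
    unfolding admissible_multiplicities_def
  proof (clarify)
    fix q i assume "(q, i) \<in># ?Q"
    then obtain j where j: "q = b ^ j" "count P i div b ^ j mod b \<noteq> 0"
      by (rule in_expand_multiplicitiesD)
    let ?d = "count P i div b ^ j mod b"
    have "?d < b" using assms(1) by simp
    then have "1 \<le> ?d" "?d \<le> b - 1" using j(2) by linarith+
    moreover have "count ?Q (q, i) = ?d * i"
      using j(1) by (simp add: count_expand_multiplicities mult.commute)
    ultimately show "\<exists>m. count ?Q (q, i) = m * i \<and> 1 \<le> m \<and> m \<le> b - 1" by blast
  qed
  ultimately show ?thesis by simp
qed

lemma collapse_expand: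
  assumes "b \<ge> 2" and "P \<in> partitions_parts_le k n"
  shows "collapse_colors (expand_multiplicities b P) = P"
proof (rule multiset_eqI)
  fix i
  have "0 \<notin># P" using assms(2) by (auto simp: partitions_parts_le_def)
  then have "count P 0 = 0" by (simp add: not_in_iff)
  then show "count (collapse_colors (expand_multiplicities b P)) i = count P i"
    using assms(1)
    by (cases "i = 0") (auto simp: count_collapse_colors color_weight_expand_multiplicities)
qed

text \<open>Admissibility says that the multiplicities in color \<open>i\<close>, divided by \<open>i\<close>, are base-\<open>b\<close>
  digits. The number with these digits is the multiplicity of \<open>i\<close> in the collapsed partition:
  the formula for the weight shows that dividing by \<open>i\<close> leaves no remainder, and the
  digits can be recovered from the quotient.\<close>

lemma admissible_digits:
  assumes "b \<ge> 2" and Q: "Q \<in> colored_bary_partitions b k n" and adm: "admissible_multiplicities b Q"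
  obtains N d where "\<And>j. d j < b" "\<And>j. count Q (b ^ j, i) = i * d j" "\<And>j. j \<ge> N \<Longrightarrow> d j = 0"
    "color_weight Q i = i * (\<Sum>j<N. d j * b ^ j)"
proof -
  have inj: "inj (\<lambda>j. (b ^ j, i))" using assms(1) by (auto simp: inj_on_def)
  have "finite ((\<lambda>j. (b ^ j, i)) -` set_mset Q)"
    by (rule finite_vimageI[OF _ inj]) simp
  then obtain N where N: "j < N" if "(b ^ j, i) \<in># Q" for j
    unfolding finite_nat_set_iff_bounded by auto
  have "\<exists>d. d < b \<and> count Q (b ^ j, i) = i * d \<and> (j \<ge> N \<longrightarrow> d = 0)" for j
  proof (cases "(b ^ j, i) \<in># Q")
    case True
    then obtain m where "count Q (b ^ j, i) = m * i" "m \<le> b - 1"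
      using adm by (fastforce simp: admissible_multiplicities_def)
    then show ?thesis using assms(1) N[OF True] by (intro exI[of _ m]) auto
  next
    case False
    then have "count Q (b ^ j, i) = 0" by (simp add: not_in_iff)
    then show ?thesis using assms(1) by (intro exI[of _ 0]) auto
  qed
  then obtain d where d: "\<And>j. d j < b" "\<And>j. count Q (b ^ j, i) = i * d j" "\<And>j. j \<ge> N \<Longrightarrow> d j = 0"
    by metis
  have "color_weight Q i = (\<Sum>j<N. count Q (b ^ j, i) * b ^ j)"
    using assms(1)
  proof (rule color_weight_bary)
    fix q assume q: "(q, i) \<in># Q"
    then obtain j where "q = b ^ j" using Q by (auto simp: colored_bary_partitions_def)
    with q N show "\<exists>j<N. q = b ^ j" by blast
  qed
  also have "\<dots> = i * (\<Sum>j<N. d j * b ^ j)"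
    by (simp add: d(2) sum_distrib_left mult.assoc)
  finally show ?thesis using d that by blast
qed

lemma expand_collapse:
  assumes "b \<ge> 2" and Q: "Q \<in> colored_bary_partitions b k n" and adm: "admissible_multiplicities b Q"
  shows "expand_multiplicities b (collapse_colors Q) = Q"
proof (rule multiset_eqI, clarify)
  fix q i
  obtain N d where d: "\<And>j. d j < b" "\<And>j. count Q (b ^ j, i) = i * d j" "\<And>j. j \<ge> N \<Longrightarrow> d j = 0"
    and weight: "color_weight Q i = i * (\<Sum>j<N. d j * b ^ j)"
    by (rule admissible_digits[OF assms, where i = i]) (rule that)
  show "count (expand_multiplicities b (collapse_colors Q)) (q, i) = count Q (q, i)"
  proof (cases "q \<in> range ((^) b)")
    case True
    then obtain l where l: "q = b ^ l" by blast
    show ?thesis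
    proof (cases "i = 0")
      case True
      with l d(2) show ?thesis by (simp add: count_expand_multiplicities)
    next
      case False
      have "(\<Sum>j<N. d j * b ^ j) div b ^ l mod b = d l"
        using digit_of_sum[of d b N l] d by simp
      with False l d(2) weight show ?thesis
        by (simp add: count_expand_multiplicities count_collapse_colors)
    qed
  next
    case False
    then have "(q, i) \<notin># Q" using Q by (auto simp: colored_bary_partitions_def)
    with False show ?thesis by (simp add: count_expand_multiplicities not_in_iff)
  qed
qed

lemma collapse_colors_in:
  assumes "b \<ge> 2" and Q: "Q \<in> colored_bary_partitions b k n" and adm: "admissible_multiplicities b Q"
  shows "collapse_colors Q \<in> partitions_parts_le k n"
proof -
  have colors: "snd ` set_mset Q \<subseteq> {1..k}"
    using Q by (auto simp: colored_bary_partitions_def)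
  have parts: "set_mset (collapse_colors Q) \<subseteq> snd ` set_mset Q"
    by (auto simp: collapse_colors_def set_mset_sum split: if_splits)
  have "sum_mset (collapse_colors Q) = (\<Sum>i\<in>{1..k}. color_weight Q i div i * i)"
    using sum_mset_eq_sum_count[of "{1..k}" "collapse_colors Q" "\<lambda>x. x"] parts colors
    by (simp add: count_collapse_colors)
  also have "\<dots> = (\<Sum>i\<in>{1..k}. color_weight Q i)"
  proof (rule sum.cong)
    fix i
    have "i dvd color_weight Q i" using admissible_digits[OF assms, where i = i] by (metis dvd_triv_left)
    then show "color_weight Q i div i * i = color_weight Q i" by simp
  qed simp
  also have "\<dots> = n"
    using sum_color_weight[OF _ colors] Q
    by (simp add: colored_bary_partitions_def case_prod_unfold)
  finally show ?thesis
    using parts colors by (fastforce simp: partitions_parts_le_def)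
qed

theorem proposition2p6:
  fixes k n b :: nat
  assumes "k \<ge> 1" and "n \<ge> 1" and "b \<ge> 2"
  shows "num_partitions_parts_le k n =
    card {Q \<in> colored_bary_partitions b k n. admissible_multiplicities b Q}"
proof -
  have "bij_betw (expand_multiplicities b) (partitions_parts_le k n)
      {Q \<in> colored_bary_partitions b k n. admissible_multiplicities b Q}"
    using assms(3) collapse_expand expand_collapse expand_multiplicities_in collapse_colors_in
    by (intro bij_betw_byWitness[where f' = collapse_colors]) blast+
  then show ?thesis
    unfolding num_partitions_parts_le_def by (rule bij_betw_same_card)
qed

end
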